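(* The vectors $$Y_{m_1}\cdots Y_{m_r}Y^{*}_{n_1}\cdots Y^{*}_{n_s}\cdot 1,$$ where $r,s\ge 0$, $m_1,\dots,m_r,n_1,\dots,n_s\in\mathbb{Z}$, satisfying $$m_1\le m_2\le\cdots\le m_r\quad\text{and}\quad n_1\le n_2\le\cdots\le n_s,$$ form a basis of the algebra $\mathcal{A}$ over $\mathbb{C}$.
   Context: $\mathcal{A}$ denotes the associative algebra with identity over $\mathbb{C}$ with generators $Y_n, Y_n^{*}$ ($n\in\mathbb{Z}$), subject to the relations $$Y_mY_n+Y_{n+1}Y_{m-1}=0,\qquad Y_m^{*}Y_n^{*}+Y_{n+1}^{*}Y_{m-1}^{*}=0,\qquad Y_mY_n^{*}+Y_{n-1}^{*}Y_{m+1}=\delta_{m+n,0}$$ for $m,n\in\mathbb{Z}$. For $r=s=0$ the product is the identity $1$. *)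

theory Defs
  imports Complex_Main "HOL-Library.Poly_Mapping"
begin

datatype gen = GenY int | GenYstar int

text \<open>Words in the generators, i.e. the free monoid. It is written additively because the
  convolution product of the type of finitely supported functions expects an additive monoid
  of exponents; \<open>+\<close> is concatenation and is not commutative.\<close>

datatype word = Word (letters: "gen list")

instantiation word :: monoid_add
begin

definition zero_word :: word where "0 = Word []"

definition plus_word :: "word \<Rightarrow> word \<Rightarrow> word" where "u + v = Word (letters u @ letters v)"

instance
  by standard (simp_all add: zero_word_def plus_word_def)

end

text \<open>The free associative algebra with identity over the complex numbers on the generators:
  the monoid algebra of the words, a \<open>ring_1\<close> under convolution.\<close>

type_synonym free_alg = "word \<Rightarrow>\<^sub>0 complex"

definition free_gen :: "gen \<Rightarrow> free_alg" where
  "free_gen g = Poly_Mapping.single (Word [g]) 1"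

inductive_set relators :: "free_alg set" where
  YY: "free_gen (GenY m) * free_gen (GenY n)
       + free_gen (GenY (n + 1)) * free_gen (GenY (m - 1)) \<in> relators"
| SS: "free_gen (GenYstar m) * free_gen (GenYstar n)
       + free_gen (GenYstar (n + 1)) * free_gen (GenYstar (m - 1)) \<in> relators"
| YS: "free_gen (GenY m) * free_gen (GenYstar n)
       + free_gen (GenYstar (n - 1)) * free_gen (GenY (m + 1))
       - (if m + n = 0 then 1 else 0) \<in> relators"

text \<open>The two-sided ideal generated by the relators. Closure under negation and under
  scalar multiplication is the case of a constant factor.\<close>

inductive_set rel_ideal :: "free_alg set" where
  relator: "r \<in> relators \<Longrightarrow> r \<in> rel_ideal"
| zero: "0 \<in> rel_ideal"
| add: "x \<in> rel_ideal \<Longrightarrow> y \<in> rel_ideal \<Longrightarrow> x + y \<in> rel_ideal"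
| mult_left: "x \<in> rel_ideal \<Longrightarrow> a * x \<in> rel_ideal"
| mult_right: "x \<in> rel_ideal \<Longrightarrow> x * a \<in> rel_ideal"

lemma rel_ideal_uminus: "x \<in> rel_ideal \<Longrightarrow> - x \<in> rel_ideal"
  using rel_ideal.mult_left[of x "- 1"] by simp

lemma rel_ideal_diff: "x \<in> rel_ideal \<Longrightarrow> y \<in> rel_ideal \<Longrightarrow> x - y \<in> rel_ideal"
  using rel_ideal.add[OF _ rel_ideal_uminus] by fastforce

definition rel_equiv :: "free_alg \<Rightarrow> free_alg \<Rightarrow> bool" where
  "rel_equiv x y \<longleftrightarrow> x - y \<in> rel_ideal"

lemma equivp_rel_equiv: "equivp rel_equiv"
proof (rule equivpI)
  show "reflp rel_equiv"
    by (simp add: reflp_def rel_equiv_def rel_ideal.zero)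
  show "symp rel_equiv"
    unfolding symp_def rel_equiv_def using rel_ideal_uminus by fastforce
  show "transp rel_equiv"
    unfolding transp_def rel_equiv_def using rel_ideal.add by fastforce
qed

quotient_type alg = free_alg / rel_equiv
  by (rule equivp_rel_equiv)

text \<open>The instances are \<open>ring\<close> and \<open>monoid_mult\<close> rather than \<open>ring_1\<close>, because \<open>ring_1\<close> includes
  \<open>0 \<noteq> 1\<close>, which does not hold by construction for a quotient.\<close>

instantiation alg :: "{ring, monoid_mult}"
begin

lift_definition zero_alg :: alg is 0 .

lift_definition one_alg :: alg is 1 .

lift_definition plus_alg :: "alg \<Rightarrow> alg \<Rightarrow> alg" is "(+)"
  unfolding rel_equiv_def using rel_ideal.add by (fastforce simp: algebra_simps)

lift_definition uminus_alg :: "alg \<Rightarrow> alg" is uminus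
  unfolding rel_equiv_def using rel_ideal_uminus by fastforce

lift_definition minus_alg :: "alg \<Rightarrow> alg \<Rightarrow> alg" is "(-)"
  unfolding rel_equiv_def using rel_ideal_diff by (fastforce simp: algebra_simps)

lift_definition times_alg :: "alg \<Rightarrow> alg \<Rightarrow> alg" is "(*)"
proof -
  fix x x' y y' :: free_alg
  assume "rel_equiv x x'" and "rel_equiv y y'"
  then have "(x - x') * y + x' * (y - y') \<in> rel_ideal"
    unfolding rel_equiv_def by (intro rel_ideal.add rel_ideal.mult_left rel_ideal.mult_right)
  then show "rel_equiv (x * y) (x' * y')"
    by (simp add: rel_equiv_def algebra_simps)
qed

instance
proof
  fix a b c :: alg
  show "a + b + c = a + (b + c)"
    by transfer (simp add: add.assoc rel_equiv_def rel_ideal.zero)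
  show "a + b = b + a"
    by transfer (simp add: add.commute rel_equiv_def rel_ideal.zero)
  show "0 + a = a"
    by transfer (simp add: rel_equiv_def rel_ideal.zero)
  show "- a + a = 0"
    by transfer (simp add: rel_equiv_def rel_ideal.zero)
  show "a - b = a + - b"
    by transfer (simp add: rel_equiv_def rel_ideal.zero)
  show "a * b * c = a * (b * c)"
    by transfer (simp add: mult.assoc rel_equiv_def rel_ideal.zero)
  show "(a + b) * c = a * c + b * c"
    by transfer (simp add: distrib_right rel_equiv_def rel_ideal.zero)
  show "a * (b + c) = a * b + a * c"
    by transfer (simp add: distrib_left rel_equiv_def rel_ideal.zero)
  show "1 * a = a"
    by transfer (simp add: rel_equiv_def rel_ideal.zero)
  show "a * 1 = a"
    by transfer (simp add: rel_equiv_def rel_ideal.zero)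
qed

end

text \<open>The scalar \<open>c\<close> acts as multiplication by \<open>c\<close> times the empty word.\<close>

lift_definition scale :: "complex \<Rightarrow> alg \<Rightarrow> alg" is "\<lambda>c x. Poly_Mapping.single 0 c * x"
  unfolding rel_equiv_def by (metis rel_ideal.mult_left right_diff_distrib)

global_interpretation alg: vector_space scale
proof
  fix a b :: complex and x y :: alg
  show "scale a (x + y) = scale a x + scale a y"
    by transfer (simp add: distrib_left rel_equiv_def rel_ideal.zero)
  show "scale (a + b) x = scale a x + scale b x"
    by transfer (simp add: single_add distrib_right rel_equiv_def rel_ideal.zero)
  show "scale a (scale b x) = scale (a * b) x"
    by transfer (simp add: mult.assoc[symmetric] mult_single rel_equiv_def rel_ideal.zero)
  show "scale 1 x = x"
    by transfer (simp add: rel_equiv_def rel_ideal.zero)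
qed

lemma single_0_central:
  fixes x :: free_alg
  shows "x * Poly_Mapping.single 0 c = Poly_Mapping.single 0 c * x"
proof (induction x rule: update_induct)
  case const
  show ?case by simp
next
  case (update f a b)
  have "Poly_Mapping.update a b f = f + Poly_Mapping.single a b"
    using update(1) by (intro poly_mapping_eqI)
      (auto simp: lookup_update lookup_add lookup_single when_def in_keys_iff)
  then show ?case
    using update(3) by (simp add: distrib_left distrib_right mult_single mult.commute)
qed

lemma scale_mult_left: "scale c x * y = scale c (x * y)"
  by transfer (simp add: mult.assoc rel_equiv_def rel_ideal.zero)

lemma scale_mult_right: "x * scale c y = scale c (x * y)"
proof transfer
  fix x y :: free_alg and c :: complex
  have "x * (Poly_Mapping.single 0 c * y) = Poly_Mapping.single 0 c * (x * y)"
    by (metis mult.assoc single_0_central)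
  then show "rel_equiv (x * (Poly_Mapping.single 0 c * y)) (Poly_Mapping.single 0 c * (x * y))"
    by (simp add: rel_equiv_def rel_ideal.zero)
qed

lift_definition Y :: "int \<Rightarrow> alg" is "\<lambda>n. free_gen (GenY n)" .

lift_definition Ystar :: "int \<Rightarrow> alg" is "\<lambda>n. free_gen (GenYstar n)" .

lemma Y_Y: "Y m * Y n + Y (n + 1) * Y (m - 1) = 0"
  by transfer (simp add: rel_equiv_def rel_ideal.relator relators.YY)

lemma Ystar_Ystar: "Ystar m * Ystar n + Ystar (n + 1) * Ystar (m - 1) = 0"
  by transfer (simp add: rel_equiv_def rel_ideal.relator relators.SS)

lemma Y_Ystar: "Y m * Ystar n + Ystar (n - 1) * Y (m + 1) = (if m + n = 0 then 1 else 0)"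
proof transfer
  fix m n :: int
  show "rel_equiv (free_gen (GenY m) * free_gen (GenYstar n)
      + free_gen (GenYstar (n - 1)) * free_gen (GenY (m + 1))) (if m + n = 0 then 1 else 0)"
    unfolding rel_equiv_def by (rule rel_ideal.relator[OF relators.YS])
qed

definition monomial :: "int list \<times> int list \<Rightarrow> alg" where
  "monomial = (\<lambda>(ms, ns). prod_list (map Y ms) * prod_list (map Ystar ns))"

definition ordered_indices :: "(int list \<times> int list) set" where
  "ordered_indices = {(ms, ns). sorted ms \<and> sorted ns}"

end

theory Submission
  imports Defs "HOL-Library.FSet" "HOL-Library.Product_Lexorder"
begin

text \<open>Spanning: \<open>Ystar\<close> factors move to the right past \<open>Y\<close> factors, and a word in one kind of
  generators straightens, because in the shifted indices \<open>m\<^sub>i + i\<close> the quadratic relation says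
  that adjacent entries anticommute.

  Independence: the algebra is the Clifford algebra with generators \<open>\<psi>\<^sub>m\<close>, \<open>\<psi>\<^sup>*\<^sub>n\<close>, twisted by the
  automorphism \<open>T\<close> that shifts indices: \<open>Y\<^sub>m = \<psi>\<^sub>m T\<close> and \<open>Y\<^sup>*\<^sub>n = \<psi>\<^sup>*\<^sub>n T\<^sup>-\<^sup>1\<close>. It acts on the
  exterior algebra over two families of basis vectors, where \<open>\<psi>\<^sub>m\<close> creates in the first
  family and \<open>\<psi>\<^sup>*\<^sub>n\<close> is the sum of a creation in the second family and an annihilation
  in the first. This is the left regular representation of the Clifford algebra, so the ordered
  monomials send the vacuum to nonzero multiples of distinct basis vectors.\<close>

section \<open>Spanning\<close>

lemma poly_mapping_add_induct:
  fixes x :: "'a \<Rightarrow>\<^sub>0 'b::ab_group_add"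
  assumes "\<And>w c. P (Poly_Mapping.single w c)" and "\<And>x y. P x \<Longrightarrow> P y \<Longrightarrow> P (x + y)"
  shows "P x"
proof (induction x rule: update_induct)
  case const
  show ?case using assms(1)[of undefined 0] by simp
next
  case (update f a b)
  have "Poly_Mapping.update a b f = f + Poly_Mapping.single a b"
    using update(1) by (intro poly_mapping_eqI)
      (auto simp: lookup_update lookup_add lookup_single when_def in_keys_iff)
  then show ?case using update(3) assms by simp
qed

text \<open>The lower bound keeps \<open>n + 1\<close> in front after a step \<open>y m * y n = - y (n + 1) * y (m - 1)\<close>.\<close>

lemma straighten_Cons:
  fixes y :: "int \<Rightarrow> alg"
  assumes swap: "\<And>m n. y m * y n + y (n + 1) * y (m - 1) = 0"
  assumes "sorted ms" "\<forall>i\<in>set ms. k - 1 \<le> i" "k \<le> m"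
  shows "\<exists>c ms'. sorted ms' \<and> (\<forall>i\<in>set ms'. k \<le> i) \<and>
           y m * prod_list (map y ms) = scale c (prod_list (map y ms'))"
  using assms(2-)
proof (induction ms arbitrary: k m)
  case Nil
  then show ?case by (intro exI[of _ 1] exI[of _ "[m]"]) simp
next
  case (Cons n ms)
  have swap': "y m * y n = - (y (n + 1) * y (m - 1))"
    using swap[of m n] by (simp add: eq_neg_iff_add_eq_0)
  consider "m \<le> n" | "m = n + 1" | "n + 2 \<le> m" by linarith
  then show ?case
  proof cases
    case 1
    then show ?thesis using Cons.prems
      by (intro exI[of _ 1] exI[of _ "m # n # ms"]) force
  next
    case 2
    \<comment> \<open>For \<open>m = n + 1\<close> both terms of \<open>swap\<close> coincide, so
      twice the product vanishes.\<close>
    have "scale 2 (y m * y n) = y m * y n + y m * y n"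
      using alg.scale_left_distrib[of 1 1 "y m * y n"] by simp
    also have "\<dots> = 0" using swap[of m n] 2 by simp
    finally have "y m * y n = 0" by simp
    then have "y m * prod_list (map y (n # ms)) = 0"
      by (simp add: mult.assoc[symmetric])
    then show ?thesis by (intro exI[of _ 0] exI[of _ "[]"]) simp
  next
    case 3
    \<comment> \<open>The tail is bounded below by \<open>n = (n + 1) - 1\<close>, so the bound
      \<open>n + 1\<close> is admissible, and the result may stand right behind
      \<open>n + 1\<close>.\<close>
    have "\<exists>c ms'. sorted ms' \<and> (\<forall>i\<in>set ms'. n + 1 \<le> i) \<and>
           y (m - 1) * prod_list (map y ms) = scale c (prod_list (map y ms'))"
      by (rule Cons.IH) (use Cons.prems 3 in auto)
    then obtain c ms' where ms': "sorted ms'" "\<forall>i\<in>set ms'. n + 1 \<le> i"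
      "y (m - 1) * prod_list (map y ms) = scale c (prod_list (map y ms'))" by blast
    have "y m * prod_list (map y (n # ms)) = y m * y n * prod_list (map y ms)"
      by (simp add: mult.assoc)
    also have "\<dots> = - (y (n + 1) * (y (m - 1) * prod_list (map y ms)))"
      by (simp add: swap' mult.assoc)
    also have "\<dots> = scale (- c) (prod_list (map y ((n + 1) # ms')))"
      by (simp add: ms'(3) scale_mult_right)
    finally show ?thesis using ms'(1,2) Cons.prems
      by (intro exI[of _ "- c"] exI[of _ "(n + 1) # ms'"]) fastforce
  qed
qed

lemma straighten:
  fixes y :: "int \<Rightarrow> alg"
  assumes swap: "\<And>m n. y m * y n + y (n + 1) * y (m - 1) = 0"
  shows "\<exists>c ms'. sorted ms' \<and> prod_list (map y ms) = scale c (prod_list (map y ms'))"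
proof (induction ms)
  case Nil
  then show ?case by (intro exI[of _ 1] exI[of _ "[]"]) simp
next
  case (Cons m ms)
  then obtain c ms' where ms': "sorted ms'" "prod_list (map y ms) = scale c (prod_list (map y ms'))"
    by blast
  \<comment> \<open>Any common lower bound starts the insertion; the bound on the result is
    dropped.\<close>
  define k where "k = Min (insert m (set ms'))"
  have "\<forall>i\<in>insert m (set ms'). k \<le> i" by (simp add: k_def)
  then have "k \<le> m" "\<forall>i\<in>set ms'. k - 1 \<le> i" by force+
  from straighten_Cons[where y = y, OF swap ms'(1) this(2,1)] obtain d ms'' where
    "sorted ms''" "y m * prod_list (map y ms') = scale d (prod_list (map y ms''))" by blast
  then show ?case using ms'(2)
    by (intro exI[of _ "c * d"] exI[of _ ms'']) (simp add: scale_mult_right)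
qed

lemma monomial_in_span: "monomial p \<in> alg.span (monomial ` ordered_indices)"
proof -
  obtain ms ns where p: "p = (ms, ns)" by force
  obtain c ms' where ms': "sorted ms'" "prod_list (map Y ms) = scale c (prod_list (map Y ms'))"
    using straighten[where y = Y, OF Y_Y] by blast
  obtain d ns' where ns': "sorted ns'"
    "prod_list (map Ystar ns) = scale d (prod_list (map Ystar ns'))"
    using straighten[where y = Ystar, OF Ystar_Ystar] by blast
  have "monomial p = scale (c * d) (monomial (ms', ns'))"
    by (simp add: p monomial_def ms' ns' scale_mult_left scale_mult_right mult.commute)
  moreover have "(ms', ns') \<in> ordered_indices"
    using ms' ns' by (simp add: ordered_indices_def)
  ultimately show ?thesis by (simp add: alg.span_base alg.span_scale)
qed

section \<open>Stability of the span of all monomials under the generators\<close>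

lemma span_mult_left_closed:
  assumes gen: "\<And>s. s \<in> S \<Longrightarrow> a * s \<in> alg.span S" and "x \<in> alg.span S"
  shows "a * x \<in> alg.span S"
  using assms(2)
proof (induction rule: alg.span_induct_alt)
  case base
  show ?case by (simp add: alg.span_zero)
next
  case (step c x y)
  then show ?case
    by (simp add: distrib_left scale_mult_right gen alg.span_add alg.span_scale)
qed

lemma Y_mult_span:
  "x \<in> alg.span (range monomial) \<Longrightarrow> Y m * x \<in> alg.span (range monomial)"
proof (rule span_mult_left_closed)
  fix s assume "s \<in> range monomial"
  then obtain ms ns where "s = monomial (ms, ns)" by auto
  then have "Y m * s = monomial (m # ms, ns)" by (simp add: monomial_def mult.assoc)
  then show "Y m * s \<in> alg.span (range monomial)" by (simp add: alg.span_base)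
qed

text \<open>Each exchange with a leading \<open>Y\<close> alters the index of \<open>Ystar\<close>,
  hence the induction with \<open>n\<close> arbitrary; the scalar in the relation leaves a shorter
  monomial.\<close>

lemma Ystar_mult_monomial: "Ystar n * monomial (ms, ns) \<in> alg.span (range monomial)"
proof (induction ms arbitrary: n)
  case Nil
  have "Ystar n * monomial ([], ns) = monomial ([], n # ns)" by (simp add: monomial_def)
  then show ?case by (simp add: alg.span_base)
next
  case (Cons m ms)
  let ?d = "if m + n = 0 then 1 else 0 :: alg"
  have "Ystar n * Y m = ?d - Y (m - 1) * Ystar (n + 1)"
    using Y_Ystar[of "m - 1" "n + 1"] by (simp add: eq_diff_eq add.commute)
  then have "Ystar n * monomial (m # ms, ns)
      = (?d - Y (m - 1) * Ystar (n + 1)) * monomial (ms, ns)"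
    by (simp add: monomial_def mult.assoc[symmetric])
  also have "\<dots> = ?d * monomial (ms, ns) - Y (m - 1) * (Ystar (n + 1) * monomial (ms, ns))"
    by (simp add: left_diff_distrib mult.assoc)
  also have "\<dots> \<in> alg.span (range monomial)"
    using Cons[of "n + 1"] by (intro alg.span_diff Y_mult_span) (simp_all add: alg.span_base alg.span_zero)
  finally show ?case .
qed

lemma Ystar_mult_span:
  "x \<in> alg.span (range monomial) \<Longrightarrow> Ystar n * x \<in> alg.span (range monomial)"
  by (rule span_mult_left_closed) (auto simp: Ystar_mult_monomial)

lemma abs_alg_single_in_span:
  "abs_alg (Poly_Mapping.single (Word gs) c) \<in> alg.span (range monomial)"
proof (induction gs)
  case Nil
  have "monomial ([], []) = abs_alg 1"
    by (simp add: monomial_def one_alg.abs_eq[symmetric])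
  then have "abs_alg (Poly_Mapping.single (Word []) c) = scale c (monomial ([], []))"
    by (simp add: scale.abs_eq zero_word_def)
  then show ?case by (simp add: alg.span_base alg.span_scale)
next
  case (Cons g gs)
  have "abs_alg (Poly_Mapping.single (Word (g # gs)) c)
      = abs_alg (free_gen g) * abs_alg (Poly_Mapping.single (Word gs) c)"
    by (simp add: times_alg.abs_eq free_gen_def mult_single plus_word_def)
  then show ?case
    using Cons by (cases g) (simp_all add: Y_mult_span Ystar_mult_span flip: Y.abs_eq Ystar.abs_eq)
qed

lemma span_range_monomial: "x \<in> alg.span (range monomial)"
proof (induction x rule: alg.abs_induct)
  fix x :: free_alg
  show "abs_alg x \<in> alg.span (range monomial)"
  proof (induction x rule: poly_mapping_add_induct)
    case (1 w c)
    show ?case using abs_alg_single_in_span by (cases w) simp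
  next
    case (2 x y)
    then show ?case by (simp add: plus_alg.abs_eq[symmetric] alg.span_add)
  qed
qed

lemma span_ordered_monomials: "alg.span (monomial ` ordered_indices) = UNIV"
proof -
  have "alg.span (range monomial) \<subseteq> alg.span (monomial ` ordered_indices)"
    by (rule alg.span_minimal) (auto simp: monomial_in_span)
  then show ?thesis using span_range_monomial by blast
qed

section \<open>A twisted Fock representation\<close>

text \<open>A finite set \<open>B\<close> stands for the wedge product of its elements in increasing order;
  functions on finite sets are (formal, possibly infinite) combinations of these.\<close>

definition exchange_sign :: "'a::linorder \<Rightarrow> 'a fset \<Rightarrow> complex" where
  "exchange_sign a B = (- 1) ^ card {b \<in> fset B. b < a}"

text \<open>Left exterior multiplication by the basis vector \<open>a\<close>; reading off
  coefficients keeps it defined on infinite combinations.\<close>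

definition create :: "'a::linorder \<Rightarrow> ('a fset \<Rightarrow> complex) \<Rightarrow> 'a fset \<Rightarrow> complex" where
  "create a f B = (if a |\<in>| B then exchange_sign a B * f (B |-| {|a|}) else 0)"

text \<open>Contraction with the dual basis vector, the adjoint of \<open>create a\<close>.\<close>

definition annih :: "'a::linorder \<Rightarrow> ('a fset \<Rightarrow> complex) \<Rightarrow> 'a fset \<Rightarrow> complex" where
  "annih a f B = (if a |\<in>| B then 0 else exchange_sign a B * f (finsert a B))"

section \<open>Canonical anticommutation relations\<close>

lemma exchange_sign_finsert:
  assumes "b |\<notin>| B"
  shows "exchange_sign a (finsert b B) = (if b < a then - exchange_sign a B else exchange_sign a B)"
proof -
  have "{c \<in> fset (finsert b B). c < a} =
      (if b < a then insert b {c \<in> fset B. c < a} else {c \<in> fset B. c < a})" by auto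
  with assms show ?thesis by (simp add: exchange_sign_def)
qed

lemma exchange_sign_square_mult [simp]: "exchange_sign a B * (exchange_sign a B * z) = z"
  by (simp add: exchange_sign_def mult.assoc[symmetric] power_mult_distrib[symmetric])

lemma exchange_sign_nonzero [simp]: "exchange_sign a B \<noteq> 0"
  by (simp add: exchange_sign_def)

text \<open>Only the larger label has to pass the smaller one, so the two orders of creation differ
  by one sign.\<close>

lemma create_create: "create a (create b f) B + create b (create a f) B = 0"
proof (cases "a \<noteq> b \<and> a |\<in>| B \<and> b |\<in>| B")
  case True
  then obtain C where "B = finsert a (finsert b C)" "a |\<notin>| C" "b |\<notin>| C"
    by (metis (no_types) finsert_iff mk_disjoint_finsert)
  moreover from this have "C |-| {|a|} = C" "C |-| {|b|} = C" by auto
  ultimately show ?thesis using True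
    by (auto simp: create_def exchange_sign_finsert finsert_fminus_if)
qed (auto simp: create_def)

lemma annih_annih: "annih a (annih b f) B + annih b (annih a f) B = 0"
proof (cases "a \<noteq> b \<and> a |\<notin>| B \<and> b |\<notin>| B")
  case True
  then show ?thesis
    by (auto simp: annih_def exchange_sign_finsert finsert_commute[of a b] algebra_simps)
qed (auto simp: annih_def)

text \<open>For \<open>a = b\<close> exactly one summand survives, depending on whether
  \<open>a\<close> lies in \<open>B\<close>, and its two signs cancel. For distinct labels the two
  orders have opposite signs.\<close>

lemma create_annih:
  "create a (annih b f) B + annih b (create a f) B = (if a = b then f B else 0)"
proof (cases "a |\<in>| B")
  case True
  then obtain C where C: "B = finsert a C" "a |\<notin>| C"
    by (metis mk_disjoint_finsert)
  show ?thesis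
  proof (cases "a = b \<or> b |\<in>| C")
    case True
    then show ?thesis
    proof
      assume "a = b"
      with C(2) show ?thesis unfolding C(1)
        by (simp add: create_def annih_def exchange_sign_finsert fminus_finsert_absorb)
    next
      assume "b |\<in>| C"
      with C(2) show ?thesis unfolding C(1)
        by (force simp: create_def annih_def fminus_finsert_absorb)
    qed
  next
    case False
    then consider "a < b" "\<not> b < a" "b \<noteq> a" | "b < a" "\<not> a < b" "b \<noteq> a" by force
    then show ?thesis
      by cases (use C(2) False in \<open>simp_all add: C(1) create_def annih_def exchange_sign_finsert
        fminus_finsert_absorb finsert_commute[of b a C]\<close>)
  qed
next
  case False
  then show ?thesis
    by (cases "a = b") (simp_all add: create_def annih_def exchange_sign_finsert fminus_finsert_absorb)
qed

definition delta :: "'a fset \<Rightarrow> 'a fset \<Rightarrow> complex" where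
  "delta B C = (if C = B then 1 else 0)"

lemma create_delta:
  assumes "a |\<notin>| B"
  shows "create a (delta B) = (\<lambda>C. exchange_sign a B * delta (finsert a B) C)"
proof
  fix C
  have "a |\<in>| C \<and> C |-| {|a|} = B \<longleftrightarrow> C = finsert a B"
    using assms fminus_finsert_absorb[of a B] finsert_fminus[of a C] by (metis finsertI1)
  then show "create a (delta B) C = exchange_sign a B * delta (finsert a B) C"
    using assms
    by (cases "C = finsert a B")
      (simp_all add: create_def delta_def exchange_sign_finsert fminus_finsert_absorb)
qed

lemma annih_delta:
  assumes "a |\<notin>| B"
  shows "annih a (delta B) = (\<lambda>C. 0)"
proof
  fix C
  have "finsert a C \<noteq> B" using assms by blast
  then show "annih a (delta B) C = 0" by (simp add: annih_def delta_def)
qed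

lemma create_linear:
  "create a (\<lambda>B. c * f B + d * h B) B = c * create a f B + d * create a h B"
  by (simp add: create_def algebra_simps)

lemma annih_linear:
  "annih a (\<lambda>B. c * f B + d * h B) B = c * annih a f B + d * annih a h B"
  by (simp add: annih_def algebra_simps)

text \<open>\<open>(False, i)\<close> is the \<open>i\<close>-th basis vector of the first family, \<open>(True, i)\<close> that of the
  second. The opposite directions are forced by \<open>T \<psi>\<^sub>m T\<^sup>-\<^sup>1 = \<psi>\<^sub>m\<^sub>+\<^sub>1\<close> and
  \<open>T \<psi>\<^sup>*\<^sub>n T\<^sup>-\<^sup>1 = \<psi>\<^sup>*\<^sub>n\<^sub>-\<^sub>1\<close>.\<close>

definition shift :: "int \<Rightarrow> bool \<times> int \<Rightarrow> bool \<times> int" where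
  "shift k = (\<lambda>(b, i). (b, if b then i - k else i + k))"

section \<open>Shifts of labels and translations of vectors\<close>

lemma shift_simps [simp]: "shift k (False, i) = (False, i + k)" "shift k (True, i) = (True, i - k)"
  by (simp_all add: shift_def)

lemma shift_shift [simp]: "shift k (shift l a) = shift (k + l) a"
  by (simp add: shift_def split: prod.split)

lemma shift_comp [simp]: "shift k \<circ> shift l = shift (k + l)"
  by (simp add: fun_eq_iff)

lemma shift_0 [simp]: "shift 0 a = a"
  by (simp add: shift_def split: prod.split)

text \<open>A shift keeps the family and is monotone within it, so it preserves the order and
  therefore the exchange signs.\<close>

lemma shift_less_iff: "shift k a < b \<longleftrightarrow> a < shift (- k) b"
  by (cases a; cases b) (auto simp: shift_def less_prod_def)

lemma shift_eq_iff: "shift k a = b \<longleftrightarrow> a = shift (- k) b"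
  by auto

lemma inj_shift: "inj (shift k)"
  by (rule injI) (simp add: shift_eq_iff)

lemma fimage_shift_0 [simp]: "shift 0 |`| B = B"
  by (simp add: fset.map_ident_strong)

lemma shift_mem_iff: "a \<in> shift k ` A \<longleftrightarrow> shift (- k) a \<in> A"
  by (force simp: image_iff)

lemma exchange_sign_shift: "exchange_sign a (shift k |`| B) = exchange_sign (shift (- k) a) B"
proof -
  have "{b \<in> fset (shift k |`| B). b < a} = shift k ` {b \<in> fset B. b < shift (- k) a}"
    by (auto simp: shift_less_iff shift_mem_iff)
  then show ?thesis
    by (simp add: exchange_sign_def card_image inj_on_subset[OF inj_shift])
qed

text \<open>The \<open>k\<close>-th power of \<open>T\<close>; acting on coefficients puts the
  inverse shift on the argument.\<close>

definition translate :: "int \<Rightarrow> ((bool \<times> int) fset \<Rightarrow> complex) \<Rightarrow> (bool \<times> int) fset \<Rightarrow> complex" where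
  "translate k f B = f (shift (- k) |`| B)"

lemma translate_translate [simp]: "translate k (translate l f) = translate (k + l) f"
  by (simp add: translate_def fun_eq_iff minus_diff_commute)

lemma translate_0 [simp]: "translate 0 f = f"
  by (simp add: translate_def fun_eq_iff)

lemma fimage_shift_minus: "shift k |`| (B |-| {|a|}) = (shift k |`| B) |-| {|shift k a|}"
  by (auto dest: injD[OF inj_shift])

lemma translate_create: "translate k (create a f) = create (shift k a) (translate k f)"
  by (simp add: translate_def create_def fun_eq_iff shift_mem_iff exchange_sign_shift fimage_shift_minus)

lemma translate_annih: "translate k (annih a f) = annih (shift k a) (translate k f)"
  by (simp add: translate_def annih_def fun_eq_iff shift_mem_iff exchange_sign_shift)

lemma translate_delta: "translate k (delta B) = delta (shift k |`| B)"
  by (auto simp: translate_def delta_def fun_eq_iff)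

text \<open>The index \<open>- 1 - n\<close> makes \<open>\<psi>\<^sub>m\<close> and \<open>\<psi>\<^sup>*\<^sub>n\<^sub>-\<^sub>1\<close> anticommute to \<open>\<delta>\<^bsub>m + n, 0\<^esub>\<close>,
  as \<open>Y\<^sub>m Y\<^sup>*\<^sub>n = \<psi>\<^sub>m \<psi>\<^sup>*\<^sub>n\<^sub>-\<^sub>1\<close> requires.\<close>

fun act :: "gen \<Rightarrow> ((bool \<times> int) fset \<Rightarrow> complex) \<Rightarrow> (bool \<times> int) fset \<Rightarrow> complex" where
  "act (GenY m) f = create (False, m) (translate 1 f)"
| "act (GenYstar n) f = (\<lambda>B. create (True, n) (translate (- 1) f) B
      + annih (False, - 1 - n) (translate (- 1) f) B)"

section \<open>Verification of the defining relations\<close>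

lemma translate_linear:
  "translate k (\<lambda>B. c * f B + d * h B) = (\<lambda>B. c * translate k f B + d * translate k h B)"
  by (rule ext) (simp add: translate_def)

lemma act_linear:
  "act g (\<lambda>B. c * f B + d * h B) = (\<lambda>B. c * act g f B + d * act g h B)"
  by (cases g) (simp_all add: fun_eq_iff translate_linear create_linear annih_linear algebra_simps)

lemma create_add: "create a (\<lambda>B. f B + h B) B = create a f B + create a h B"
  by (simp add: create_def algebra_simps)

lemma annih_add: "annih a (\<lambda>B. f B + h B) B = annih a f B + annih a h B"
  by (simp add: annih_def algebra_simps)

lemma translate_add: "translate k (\<lambda>B. f B + h B) = (\<lambda>B. translate k f B + translate k h B)"
  by (rule ext) (simp add: translate_def)

text \<open>Moving the translations inward raises \<open>n\<close> to \<open>n + 1\<close> and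
  \<open>m - 1\<close> to \<open>m\<close>, leaving the same two creations in opposite
  orders.\<close>

lemma act_YY: "act (GenY m) (act (GenY n) f) B + act (GenY (n + 1)) (act (GenY (m - 1)) f) B = 0"
  using create_create[of "(False, m)" "(False, n + 1)" "translate 2 f" B]
  by (simp add: translate_create add.commute)

lemma act_SS_expand:
  "act (GenYstar m) (act (GenYstar n) f) B =
     create (True, m) (create (True, n + 1) (translate (- 2) f)) B
     + create (True, m) (annih (False, - 2 - n) (translate (- 2) f)) B
     + annih (False, - 1 - m) (create (True, n + 1) (translate (- 2) f)) B
     + annih (False, - 1 - m) (annih (False, - 2 - n) (translate (- 2) f)) B"
  by (simp add: translate_create translate_annih translate_add create_add annih_add
      minus_diff_commute)

text \<open>In a mixed pair the labels lie in different families, so all four pairs anticommute to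
  0.\<close>

lemma act_SS: "act (GenYstar m) (act (GenYstar n) f) B
    + act (GenYstar (n + 1)) (act (GenYstar (m - 1)) f) B = 0"
proof -
  let ?f = "translate (- 2) f"
  let ?m = "(True, m)" and ?n = "(True, n + 1)"
  let ?m' = "(False, - 1 - m)" and ?n' = "(False, - 2 - n)"
  have *: "- 1 - (n + 1) = - 2 - n" "- 2 - (m - 1) = - 1 - m" "m - 1 + 1 = m" by simp_all
  have "create ?n (create ?m ?f) B = - create ?m (create ?n ?f) B"
    "annih ?n' (annih ?m' ?f) B = - annih ?m' (annih ?n' ?f) B"
    "annih ?n' (create ?m ?f) B = - create ?m (annih ?n' ?f) B"
    "create ?n (annih ?m' ?f) B = - annih ?m' (create ?n ?f) B"
    using create_create[of ?m ?n ?f B] annih_annih[of ?m' ?n' ?f B]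
      create_annih[of ?m ?n' ?f B] create_annih[of ?n ?m' ?f B]
    by (simp_all add: add_eq_0_iff)
  then show ?thesis unfolding act_SS_expand * by simp
qed

text \<open>The translations cancel. The one possibly nonzero anticommutator is that of creation at
  \<open>(False, m)\<close> and annihilation at \<open>(False, - n)\<close>.\<close>

lemma act_YS: "act (GenY m) (act (GenYstar n) f) B
    + act (GenYstar (n - 1)) (act (GenY (m + 1)) f) B = (if m + n = 0 then f B else 0)"
  using create_create[of "(False, m)" "(True, n - 1)" f B]
    create_annih[of "(False, m)" "(False, - n)" f B]
  by (auto simp: translate_create translate_annih translate_add create_add annih_add ac_simps)

section \<open>Representation of the free algebra and of its quotient\<close>

fun word_act where "word_act (Word gs) f = foldr act gs f"

lemma word_act_0: "word_act 0 f = f"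
  by (simp add: zero_word_def)

lemma word_act_add: "word_act (u + v) f = word_act u (word_act v f)"
  by (cases u; cases v) (simp add: plus_word_def)

lemma word_act_linear:
  "word_act w (\<lambda>B. c * f B + d * h B) = (\<lambda>B. c * word_act w f B + d * word_act w h B)"
proof (cases w)
  case (Word gs)
  show ?thesis unfolding Word by (induction gs) (simp_all add: act_linear)
qed

definition free_rep :: "free_alg \<Rightarrow> ((bool \<times> int) fset \<Rightarrow> complex) \<Rightarrow> (bool \<times> int) fset \<Rightarrow> complex" where
  "free_rep x f B = (\<Sum>w\<in>Poly_Mapping.keys x. Poly_Mapping.lookup x w * word_act w f B)"

lemma free_rep_add: "free_rep (x + y) f = (\<lambda>B. free_rep x f B + free_rep y f B)"
  unfolding free_rep_def
  by (rule ext, rule setsum_keys_plus_distrib) (simp_all add: distrib_right)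

lemma free_rep_single: "free_rep (Poly_Mapping.single w c) f = (\<lambda>B. c * word_act w f B)"
  by (simp add: free_rep_def fun_eq_iff)

lemma free_rep_gen: "free_rep (free_gen g) f = act g f"
  by (simp add: free_gen_def free_rep_single)

lemma free_rep_1: "free_rep 1 f = f"
  by (simp add: free_rep_single word_act_0 flip: single_one)

lemma free_rep_0: "free_rep 0 f = (\<lambda>B. 0)"
  by (simp add: free_rep_def fun_eq_iff)

lemma free_rep_linear:
  "free_rep x (\<lambda>B. c * f B + d * h B) = (\<lambda>B. c * free_rep x f B + d * free_rep x h B)"
  by (simp add: free_rep_def fun_eq_iff word_act_linear algebra_simps sum.distrib sum_distrib_left)

lemma free_rep_mult: "free_rep (x * y) f = free_rep x (free_rep y f)"
proof (induction x rule: poly_mapping_add_induct)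
  case (1 w c)
  show ?case
  proof (induction y rule: poly_mapping_add_induct)
    case (1 v d)
    show ?case
      using word_act_linear[of w d "word_act v f" 0 "\<lambda>_. 0"]
      by (simp add: mult_single free_rep_single word_act_add mult.assoc)
  next
    case (2 x y)
    then show ?case
      using word_act_linear[of w 1 "free_rep x f" 1 "free_rep y f"]
      by (simp add: distrib_left free_rep_add free_rep_single)
  qed
next
  case (2 x y)
  then show ?case by (simp add: distrib_right free_rep_add)
qed

lemma free_rep_minus: "free_rep (- x) f = (\<lambda>B. - free_rep x f B)"
  by (simp add: free_rep_def fun_eq_iff sum_negf)

lemma free_rep_diff: "free_rep (x - y) f = (\<lambda>B. free_rep x f B - free_rep y f B)"
  using free_rep_add[of x "- y" f] by (simp add: free_rep_minus)

text \<open>The vector \<open>f\<close> stays arbitrary because a right factor acts first and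
  changes it.\<close>

lemma free_rep_ideal: "x \<in> rel_ideal \<Longrightarrow> free_rep x f = (\<lambda>B. 0)"
proof (induction arbitrary: f rule: rel_ideal.induct)
  case (relator r)
  then show ?case
    by cases (auto simp: fun_eq_iff free_rep_add free_rep_diff free_rep_mult free_rep_gen
        free_rep_0 free_rep_1 act_YY act_SS act_YS simp del: act.simps)
next
  case (mult_left x a)
  then show ?case using free_rep_linear[of a 0 f 0 f] by (simp add: free_rep_mult)
qed (simp_all add: free_rep_add free_rep_mult free_rep_0)

lift_definition rep :: "alg \<Rightarrow> ((bool \<times> int) fset \<Rightarrow> complex) \<Rightarrow> (bool \<times> int) fset \<Rightarrow> complex"
  is free_rep
proof -
  fix x y :: free_alg
  assume "rel_equiv x y"
  then have "free_rep x f B - free_rep y f B = 0" for f B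
    using free_rep_ideal[of "x - y" f] by (simp add: rel_equiv_def free_rep_diff fun_eq_iff)
  then show "free_rep x = free_rep y" by (simp add: fun_eq_iff)
qed

lemma rep_mult: "rep (x * y) f = rep x (rep y f)"
  by (induction x rule: alg.abs_induct, induction y rule: alg.abs_induct)
     (simp add: rep.abs_eq times_alg.abs_eq free_rep_mult)

lemma rep_1: "rep 1 f = f"
  by (simp add: rep.abs_eq one_alg.abs_eq free_rep_1)

lemma rep_0: "rep 0 f = (\<lambda>B. 0)"
  by (simp add: rep.abs_eq zero_alg.abs_eq free_rep_0)

lemma rep_add: "rep (x + y) f = (\<lambda>B. rep x f B + rep y f B)"
  by (induction x rule: alg.abs_induct, induction y rule: alg.abs_induct)
     (simp add: rep.abs_eq plus_alg.abs_eq free_rep_add)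

lemma rep_scale: "rep (scale c x) f = (\<lambda>B. c * rep x f B)"
  by (induction x rule: alg.abs_induct)
     (simp add: rep.abs_eq scale.abs_eq free_rep_mult free_rep_single word_act_0)

lemma rep_Y: "rep (Y m) f = act (GenY m) f"
  by (simp add: rep.abs_eq Y.abs_eq free_rep_gen del: act.simps)

lemma rep_Ystar: "rep (Ystar n) f = act (GenYstar n) f"
  by (simp add: rep.abs_eq Ystar.abs_eq free_rep_gen del: act.simps)

text \<open>With indices counted from 0, this is the set of the numbers \<open>m\<^sub>i + i\<close>, which are distinct
  when the list is sorted.\<close>

fun occupied :: "int list \<Rightarrow> int fset" where
  "occupied [] = {||}"
| "occupied (m # ms) = finsert m ((+) 1 |`| occupied ms)"

lemma occupied_ge: "\<forall>j\<in>set ms. m \<le> j \<Longrightarrow> i |\<in>| occupied ms \<Longrightarrow> m \<le> i"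
proof (induction ms arbitrary: i)
  case (Cons n ms)
  from Cons.prems(2) have "i = n \<or> i - 1 |\<in>| occupied ms" by auto
  then show ?case using Cons.IH[of "i - 1"] Cons.prems(1) by auto
qed simp

text \<open>Makes the head the strict minimum of the occupied set: it can be read off from the set,
  and creating it meets an empty slot.\<close>

lemma occupied_shift_gt: "sorted (m # ms) \<Longrightarrow> i |\<in>| (+) 1 |`| occupied ms \<Longrightarrow> m < i"
  using occupied_ge[of ms m] by force

lemma occupied_inj: "sorted ms \<Longrightarrow> sorted ms' \<Longrightarrow> occupied ms = occupied ms' \<Longrightarrow> ms = ms'"
proof (induction ms arbitrary: ms')
  case Nil
  then show ?case by (cases ms') auto
next
  case (Cons m ms)
  then obtain m' ns where ms': "ms' = m' # ns" by (cases ms') auto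
  note gt = occupied_shift_gt[OF Cons.prems(1)] occupied_shift_gt[OF Cons.prems(2)[unfolded ms']]
  have eq: "finsert m ((+) 1 |`| occupied ms) = finsert m' ((+) 1 |`| occupied ns)"
    using Cons.prems(3) ms' by simp
  then have "m' |\<in>| finsert m ((+) 1 |`| occupied ms)" "m |\<in>| finsert m' ((+) 1 |`| occupied ns)"
    by (metis finsertI1)+
  then have m: "m = m'" using gt by fastforce
  have "(+) 1 |`| occupied ms = (+) 1 |`| occupied ns"
  proof -
    have "m |\<notin>| (+) 1 |`| occupied ms" "m |\<notin>| (+) 1 |`| occupied ns" using gt m by blast+
    then show ?thesis using eq unfolding m by (rule finsert_ident[THEN iffD1])
  qed
  then have "occupied ms = occupied ns"
    by (rule injD[OF fset.inj_map, rotated]) simp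
  then show ?case using Cons m ms' by simp
qed

text \<open>The \<open>Y\<close> factors act after the \<open>Ystar\<close> factors, and each of them shifts the second family
  down by 1.\<close>

definition state :: "int list \<times> int list \<Rightarrow> (bool \<times> int) fset" where
  "state = (\<lambda>(ms, ns). Pair False |`| occupied ms |\<union>|
     (\<lambda>i. (True, i - int (length ms))) |`| occupied ns)"

section \<open>Vacuum images of ordered monomials and independence\<close>

lemma state_Cons_left: "state (m # ms, ns) = finsert (False, m) (shift 1 |`| state (ms, ns))"
  by (simp add: state_def fimage_funion o_def algebra_simps)

lemma state_Cons_right: "state ([], n # ns) = finsert (True, n) (shift (- 1) |`| state ([], ns))"
  by (simp add: state_def o_def algebra_simps)

text \<open>The first family gives \<open>ms\<close>, hence its length, which undoes the shift of
  the second family.\<close>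

lemma inj_on_state: "inj_on state ordered_indices"
proof (rule inj_onI, clarsimp simp: ordered_indices_def)
  fix ms ns ms' ns'
  assume sorted: "sorted ms" "sorted ns" "sorted ms'" "sorted ns'"
    and eq: "state (ms, ns) = state (ms', ns')"
  have F: "i |\<in>| occupied ms \<longleftrightarrow> (False, i) |\<in>| state (ms, ns)"
    and T: "i |\<in>| occupied ns \<longleftrightarrow> (True, i - int (length ms)) |\<in>| state (ms, ns)" for i ms ns
    by (auto simp: state_def)
  have "occupied ms = occupied ms'"
    using F eq by (intro fset_eqI) metis
  then have ms: "ms = ms'" using occupied_inj sorted by blast
  then have "occupied ns = occupied ns'"
    using T eq by (intro fset_eqI) metis
  then show "ms = ms' \<and> ns = ns'" using occupied_inj sorted ms by blast
qed

lemma rep_monomial: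
  assumes "p \<in> ordered_indices"
  shows "\<exists>c. c \<noteq> 0 \<and> rep (monomial p) (delta {||}) = (\<lambda>B. c * delta (state p) B)"
proof -
  have act_scale: "act g (\<lambda>B. c * f B) = (\<lambda>B. c * act g f B)" for g c f
    using act_linear[of g c f 0 f] by simp
  obtain ms ns where p: "p = (ms, ns)" "sorted ms" "sorted ns"
    using assms by (auto simp: ordered_indices_def)
  have ns: "\<exists>c. c \<noteq> 0 \<and> rep (monomial ([], ns)) (delta {||}) = (\<lambda>B. c * delta (state ([], ns)) B)"
    using p(3)
  proof (induction ns)
    case Nil
    have "rep (monomial ([], [])) (delta {||}) = (\<lambda>B. 1 * delta (state ([], [])) B)"
      by (simp add: monomial_def rep_1 state_def)
    then show ?case by (metis one_neq_zero)
  next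
    case (Cons n ns)
    then obtain c where c: "c \<noteq> 0"
      "rep (monomial ([], ns)) (delta {||}) = (\<lambda>B. c * delta (state ([], ns)) B)" by auto
    let ?S = "shift (- 1) |`| state ([], ns)"
    \<comment> \<open>The \<open>Ystar\<close> factors act before any \<open>Y\<close>, so the first
      family is empty and the annihilation term vanishes.\<close>
    have notin: "(True, n) |\<notin>| ?S" "(False, i) |\<notin>| ?S" for i
      using occupied_shift_gt[OF Cons.prems, of n] by (auto simp: state_def)
    have "rep (monomial ([], n # ns)) (delta {||})
        = act (GenYstar n) (rep (monomial ([], ns)) (delta {||}))"
      by (simp add: monomial_def rep_mult rep_Ystar)
    also have "\<dots> = (\<lambda>B. (c * exchange_sign (True, n) ?S) * delta (state ([], n # ns)) B)"
      by (simp only: c act_scale) (simp add: translate_delta create_delta[OF notin(1)]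
          annih_delta[OF notin(2)] state_Cons_right mult.assoc)
    finally show ?case using c(1) by (metis no_zero_divisors exchange_sign_nonzero)
  qed
  show ?thesis unfolding p(1) using p(2)
  proof (induction ms)
    case Nil
    show ?case by (rule ns)
  next
    case (Cons m ms)
    then obtain c where c: "c \<noteq> 0"
      "rep (monomial (ms, ns)) (delta {||}) = (\<lambda>B. c * delta (state (ms, ns)) B)" by auto
    let ?S = "shift 1 |`| state (ms, ns)"
    have notin: "(False, m) |\<notin>| ?S"
      using occupied_shift_gt[OF Cons.prems, of m] by (auto simp: state_def)
    have "rep (monomial (m # ms, ns)) (delta {||})
        = act (GenY m) (rep (monomial (ms, ns)) (delta {||}))"
      by (simp add: monomial_def rep_mult rep_Y)
    also have "\<dots> = (\<lambda>B. (c * exchange_sign (False, m) ?S) * delta (state (m # ms, ns)) B)"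
      by (simp only: c act_scale) (simp add: translate_delta create_delta[OF notin] state_Cons_left mult.assoc)
    finally show ?case using c(1) by (metis no_zero_divisors exchange_sign_nonzero)
  qed
qed

lemma rep_monomial_eq_0_iff:
  assumes "p \<in> ordered_indices" "q \<in> ordered_indices"
  shows "rep (monomial p) (delta {||}) (state q) = 0 \<longleftrightarrow> p \<noteq> q"
proof -
  obtain c where "c \<noteq> 0" "rep (monomial p) (delta {||}) = (\<lambda>B. c * delta (state p) B)"
    using rep_monomial[OF assms(1)] by blast
  then show ?thesis using assms by (auto simp: delta_def inj_on_eq_iff[OF inj_on_state])
qed

lemma inj_on_monomial: "inj_on monomial ordered_indices"
  by (rule inj_onI) (metis rep_monomial_eq_0_iff)

text \<open>The coefficient at \<open>state p\<close> of the vacuum image is a linear functional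
  that kills the span of the other ordered monomials but not \<open>monomial p\<close>.\<close>

lemma independent_monomial: "alg.independent (monomial ` ordered_indices)"
  unfolding alg.dependent_def
proof (clarify)
  fix p
  let ?S = "monomial ` ordered_indices - {monomial p}"
  assume p: "p \<in> ordered_indices" and "monomial p \<in> alg.span ?S"
  from this(2) have "rep (monomial p) (delta {||}) (state p) = 0"
  proof (induction rule: alg.span_induct_alt)
    case base
    show ?case by (simp add: rep_0)
  next
    case (step c x y)
    then obtain q where q: "q \<in> ordered_indices" "x = monomial q" "q \<noteq> p" by blast
    then have "rep x (delta {||}) (state p) = 0" using p rep_monomial_eq_0_iff by blast
    with step show ?case by (simp add: rep_add rep_scale)
  qed
  then show False using p rep_monomial_eq_0_iff by blast
qed

theorem proposition3p5:
  shows "inj_on monomial ordered_indices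
    \<and> alg.independent (monomial ` ordered_indices)
    \<and> alg.span (monomial ` ordered_indices) = UNIV"
  using inj_on_monomial independent_monomial span_ordered_monomials by blast

end
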